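(* Let $\mathcal A$ be a finite set of $m\ge2$ alternatives, $0<\varphi<1$, $n\ge1$, and consider Condorcet's model with dispersion $\varphi$ and $n$ i.i.d. samples. Let $a\in\mathcal A$, let $h_1\in\mathcal B(\mathcal A)\setminus R_{a\succ\text{others}}$, and let $0<\alpha<1$. Let $B$ be the set of alternatives that are preferred to $a$ in $h_1$. Then the following test is a level-$\alpha$ most powerful test for $H_0=R_{a\succ\text{others}}$ vs. $h_1$: for every $n$-profile $P_n\in\mathcal B(\mathcal A)^n$, $$g_{\alpha,a,B}(P_n)=\begin{cases}1&\text{if }w_{P_n}(B\succ a)>K_\alpha\\ 0&\text{if }w_{P_n}(B\succ a)<K_\alpha\\ \Gamma_\alpha&\text{if }w_{P_n}(B\succ a)=K_\alpha,\end{cases}$$ where $K_\alpha\in\mathbb R$ and $\Gamma_\alpha\in[0,1]$ are chosen such that the size of $g_{\alpha,a,B}$ is $\alpha$.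
   Context: $\mathcal B(\mathcal A)$ is the set of all irreflexive, antisymmetric, total binary relations over $\mathcal A$ (for each pair of distinct alternatives exactly one is preferred to the other; transitivity is not required); $b\succ_V c$ means $b$ is preferred to $c$ in $V$. $R_{a\succ\text{others}}=\{V\in\mathcal B(\mathcal A): a\succ_V b\text{ for all }b\ne a\}$. $\mathrm{KT}(V,W)$ is the number of unordered pairs of alternatives on which $V,W\in\mathcal B(\mathcal A)$ disagree. Condorcet's model with fixed dispersion $\varphi$: sample space $\mathcal B(\mathcal A)^n$, parameter space $\mathcal B(\mathcal A)$; given parameter $W$, the $n$ relations are i.i.d. with $\pi_W(V)=\frac1Z\varphi^{\mathrm{KT}(V,W)}$, $Z$ the normalization factor. For a profile $P$, $P(b\succ c)$ is the number of votes in $P$ in which $b$ is preferred to $c$; $w_P(b\succ c)=P(b\succ c)-P(c\succ b)$; $w_P(B\succ a)=\sum_{b\in B}w_P(b\succ a)$. Testing: a (randomized) test is a function $f$ from the sample space to $[0,1]$ ($f(P)$ is the probability of rejecting $H_0$). $\mathrm{Size}(f,h_0)=E_{P\sim\pi_{h_0}}f(P)$, $\mathrm{Size}(f)=\sup_{h_0\in H_0}\mathrm{Size}(f,h_0)$, $\mathrm{Power}(f,h_1)=E_{P\sim\pi_{h_1}}f(P)$. A level-$\alpha$ most powerful test for $H_0$ vs. $h_1$ is a test $f$ with $\mathrm{Size}(f)=\alpha$ such that $\mathrm{Power}(f,h_1)\ge\mathrm{Power}(g,h_1)$ for every test $g$ with $\mathrm{Size}(g)\le\alpha$. *)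

theory Defs
  imports "HOL-Probability.Probability"
begin

(* A relation is a set of pairs; (b, c) \<in> V reads "b is preferred to c in V". *)

definition tournaments :: "'a set \<Rightarrow> 'a rel set" where
  "tournaments A = {V. V \<subseteq> A \<times> A \<and> irrefl V \<and> antisym V \<and> total_on A V}"

definition top_tournaments :: "'a set \<Rightarrow> 'a \<Rightarrow> 'a rel set" where
  "top_tournaments A a = {V \<in> tournaments A. \<forall>b\<in>A - {a}. (a, b) \<in> V}"

(* Pairs are unordered: on tournaments the disagreement condition is symmetric in b and c. *)
definition KT :: "'a set \<Rightarrow> 'a rel \<Rightarrow> 'a rel \<Rightarrow> nat" where
  "KT A V W = card {{b, c} | b c. b \<in> A \<and> c \<in> A \<and> b \<noteq> c \<and> ((b, c) \<in> V \<longleftrightarrow> (b, c) \<notin> W)}"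

definition condorcet_Z :: "'a set \<Rightarrow> real \<Rightarrow> 'a rel \<Rightarrow> real" where
  "condorcet_Z A \<phi> W = (\<Sum>V\<in>tournaments A. \<phi> ^ KT A V W)"

(* embed_pmf is unspecified unless its argument is a mass function; see pmf_condorcet below. *)
definition condorcet_pmf :: "'a set \<Rightarrow> real \<Rightarrow> 'a rel \<Rightarrow> 'a rel pmf" where
  "condorcet_pmf A \<phi> W =
     embed_pmf (\<lambda>V. if V \<in> tournaments A then \<phi> ^ KT A V W / condorcet_Z A \<phi> W else 0)"

(* An n-profile is a function on {..<n}, with value undefined outside {..<n}. *)
definition profiles :: "'a set \<Rightarrow> nat \<Rightarrow> (nat \<Rightarrow> 'a rel) set" where
  "profiles A n = (\<Pi>\<^sub>E i\<in>{..<n}. tournaments A)"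

definition profile_pmf :: "'a set \<Rightarrow> real \<Rightarrow> nat \<Rightarrow> 'a rel \<Rightarrow> (nat \<Rightarrow> 'a rel) pmf" where
  "profile_pmf A \<phi> n W = Pi_pmf {..<n} undefined (\<lambda>i. condorcet_pmf A \<phi> W)"

definition votes :: "nat \<Rightarrow> (nat \<Rightarrow> 'a rel) \<Rightarrow> 'a \<Rightarrow> 'a \<Rightarrow> nat" where
  "votes n P b c = card {i \<in> {..<n}. (b, c) \<in> P i}"

definition margin :: "nat \<Rightarrow> (nat \<Rightarrow> 'a rel) \<Rightarrow> 'a \<Rightarrow> 'a \<Rightarrow> int" where
  "margin n P b c = int (votes n P b c) - int (votes n P c b)"

definition set_margin :: "nat \<Rightarrow> (nat \<Rightarrow> 'a rel) \<Rightarrow> 'a set \<Rightarrow> 'a \<Rightarrow> int" where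
  "set_margin n P B a = (\<Sum>b\<in>B. margin n P b a)"

definition is_test :: "'a set \<Rightarrow> nat \<Rightarrow> ((nat \<Rightarrow> 'a rel) \<Rightarrow> real) \<Rightarrow> bool" where
  "is_test A n f \<longleftrightarrow> (\<forall>P\<in>profiles A n. 0 \<le> f P \<and> f P \<le> 1)"

definition size_at ::
  "'a set \<Rightarrow> real \<Rightarrow> nat \<Rightarrow> ((nat \<Rightarrow> 'a rel) \<Rightarrow> real) \<Rightarrow> 'a rel \<Rightarrow> real" where
  "size_at A \<phi> n f h0 = measure_pmf.expectation (profile_pmf A \<phi> n h0) f"

definition test_size ::
  "'a set \<Rightarrow> real \<Rightarrow> nat \<Rightarrow> ((nat \<Rightarrow> 'a rel) \<Rightarrow> real) \<Rightarrow> 'a rel set \<Rightarrow> real" where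
  "test_size A \<phi> n f H0 = (SUP h0\<in>H0. size_at A \<phi> n f h0)"

definition test_power ::
  "'a set \<Rightarrow> real \<Rightarrow> nat \<Rightarrow> ((nat \<Rightarrow> 'a rel) \<Rightarrow> real) \<Rightarrow> 'a rel \<Rightarrow> real" where
  "test_power A \<phi> n f h1 = measure_pmf.expectation (profile_pmf A \<phi> n h1) f"

definition most_powerful_test ::
  "'a set \<Rightarrow> real \<Rightarrow> nat \<Rightarrow> real \<Rightarrow> 'a rel set \<Rightarrow> 'a rel \<Rightarrow> ((nat \<Rightarrow> 'a rel) \<Rightarrow> real) \<Rightarrow> bool" where
  "most_powerful_test A \<phi> n \<alpha> H0 h1 f \<longleftrightarrow>
     is_test A n f \<and> test_size A \<phi> n f H0 = \<alpha> \<and>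
     (\<forall>g. is_test A n g \<and> test_size A \<phi> n g H0 \<le> \<alpha> \<longrightarrow>
          test_power A \<phi> n f h1 \<ge> test_power A \<phi> n g h1)"

definition margin_test ::
  "nat \<Rightarrow> 'a \<Rightarrow> 'a set \<Rightarrow> real \<Rightarrow> real \<Rightarrow> (nat \<Rightarrow> 'a rel) \<Rightarrow> real" where
  "margin_test n a B K \<Gamma> P =
     (if real_of_int (set_margin n P B a) > K then 1
      else if real_of_int (set_margin n P B a) < K then 0
      else \<Gamma>)"

lemma finite_tournaments: "finite A \<Longrightarrow> finite (tournaments A)"
  by (rule finite_subset[of _ "Pow (A \<times> A)"]) (auto simp: tournaments_def)

lemma condorcet_Z_pos:
  assumes "finite A" "0 < \<phi>" "W \<in> tournaments A"
  shows "0 < condorcet_Z A \<phi> W"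
  unfolding condorcet_Z_def using assms finite_tournaments[OF assms(1)]
  by (intro sum_pos) auto

lemma pmf_condorcet:
  assumes "finite A" "0 < \<phi>" "W \<in> tournaments A"
  shows "pmf (condorcet_pmf A \<phi> W) V =
    (if V \<in> tournaments A then \<phi> ^ KT A V W / condorcet_Z A \<phi> W else 0)"
proof -
  let ?f = "\<lambda>V. if V \<in> tournaments A then \<phi> ^ KT A V W / condorcet_Z A \<phi> W else 0"
  note Z = condorcet_Z_pos[OF assms] and fin = finite_tournaments[OF assms(1)]
  have nn: "0 \<le> ?f V" for V using Z assms by auto
  have "(\<integral>\<^sup>+ V. ennreal (?f V) \<partial>count_space UNIV) = (\<Sum>V\<in>tournaments A. ennreal (?f V))"
    by (rule nn_integral_count_space'[OF fin]) auto
  also have "\<dots> = ennreal (\<Sum>V\<in>tournaments A. ?f V)"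
    by (intro sum_ennreal nn)
  also have "(\<Sum>V\<in>tournaments A. ?f V) = 1"
    using Z by (simp add: sum_divide_distrib[symmetric] condorcet_Z_def[symmetric])
  finally show ?thesis
    unfolding condorcet_pmf_def using nn by (subst pmf_embed_pmf) auto
qed

lemma set_condorcet_pmf:
  assumes "finite A" "0 < \<phi>" "W \<in> tournaments A"
  shows "set_pmf (condorcet_pmf A \<phi> W) = tournaments A"
  using condorcet_Z_pos[OF assms] assms
  by (auto simp: set_pmf_eq pmf_condorcet[OF assms])

lemma set_profile_pmf:
  assumes "finite A" "0 < \<phi>" "W \<in> tournaments A"
  shows "set_pmf (profile_pmf A \<phi> n W) = profiles A n"
  unfolding profile_pmf_def profiles_def
  by (subst set_Pi_pmf) (auto simp: set_condorcet_pmf[OF assms] PiE_dflt_def PiE_def extensional_def Pi_def)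

end

theory Submission
  imports Defs
begin

text \<open>
  The null hypothesis is composite, but the statistic does not see the difference between its
  members. Let \<open>h0\<close> be the relation obtained from \<open>h1\<close> by reversing exactly the pairs
  \<open>{a, b}\<close> with \<open>b \<in> B\<close>; then \<open>a\<close> beats everybody in \<open>h0\<close>. Two facts reduce the theorem to
  the test of the simple hypothesis \<open>h0\<close> against \<open>h1\<close>.

  First, any two hypotheses \<open>h\<close>, \<open>h'\<close> in \<open>H0\<close> agree on all pairs containing \<open>a\<close>. Reversing
  in every vote the pairs on which \<open>h\<close> and \<open>h'\<close> disagree carries the distribution of profiles
  under \<open>h\<close> to the one under \<open>h'\<close> (\<open>profile_pmf_reverse_on\<close>) and leaves the margin of \<open>B\<close>
  over \<open>a\<close> unchanged. So the rejection probability of the margin test is the same everywhere on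
  \<open>H0\<close> (\<open>size_at_margin_test_eq\<close>), and its size is its rejection probability under \<open>h0\<close>.

  Second, \<open>h0\<close> and \<open>h1\<close> differ only on the pairs that the margin counts, so a vote \<open>V\<close>
  is farther from \<open>h0\<close> than from \<open>h1\<close> by the number of \<open>b \<in> B\<close> beating \<open>a\<close> in \<open>V\<close> minus the
  number of those losing to it (\<open>KT_reverse_on_balance\<close>). Hence the likelihood ratio of \<open>h1\<close> to
  \<open>h0\<close> at a profile with margin \<open>w\<close> is \<open>\<phi> powr (- w)\<close> (\<open>profile_likelihood_ratio\<close>), which
  increases with \<open>w\<close> as \<open>\<phi> < 1\<close>. The margin test is therefore a likelihood ratio test, and the
  Neyman--Pearson argument (\<open>neyman_pearson\<close>) makes it most powerful against every test whose
  rejection probability under \<open>h0\<close> is at most \<open>\<alpha>\<close>, in particular against every test of size at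
  most \<open>\<alpha>\<close> on all of \<open>H0\<close>. A threshold and a tie probability with size exactly \<open>\<alpha>\<close> exist
  because the tie probability interpolates across the jumps of the tail of the margin
  (\<open>ex_randomized_threshold\<close>).
\<close>

section \<open>Most powerful tests between two mass functions\<close>

text \<open>
  The factor \<open>f x - g x\<close> never opposes the sign of \<open>pmf q x - k * pmf p x\<close>: wherever the latter
  is nonzero, \<open>f\<close> takes the extreme value that \<open>g\<close> cannot pass. Summing the products shows
  that a gain in power of \<open>g\<close> over \<open>f\<close> costs at least a proportional gain in level. On the boundary
  of the rejection region \<open>f\<close> is arbitrary, which leaves room for randomization.
\<close>

lemma neyman_pearson:
  fixes p q :: "'b pmf" and f g :: "'b \<Rightarrow> real"
  assumes fin: "finite S" and supp: "set_pmf p \<subseteq> S" "set_pmf q \<subseteq> S"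
    and g: "\<And>x. x \<in> S \<Longrightarrow> 0 \<le> g x \<and> g x \<le> 1"
    and reject: "\<And>x. x \<in> S \<Longrightarrow> pmf q x > k * pmf p x \<Longrightarrow> f x = 1"
    and keep: "\<And>x. x \<in> S \<Longrightarrow> pmf q x < k * pmf p x \<Longrightarrow> f x = 0"
    and "0 \<le> k"
    and level: "measure_pmf.expectation p g \<le> measure_pmf.expectation p f"
  shows "measure_pmf.expectation q g \<le> measure_pmf.expectation q f"
proof -
  have E: "measure_pmf.expectation r u = (\<Sum>x\<in>S. pmf r x * u x)"
    if "set_pmf r \<subseteq> S" for r and u :: "'b \<Rightarrow> real"
    using that by (subst integral_measure_pmf[OF fin]) auto
  have "0 \<le> (\<Sum>x\<in>S. (f x - g x) * (pmf q x - k * pmf p x))"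
  proof (rule sum_nonneg)
    fix x assume x: "x \<in> S"
    consider "pmf q x > k * pmf p x" | "pmf q x < k * pmf p x" | "pmf q x = k * pmf p x"
      by linarith
    then show "0 \<le> (f x - g x) * (pmf q x - k * pmf p x)"
    proof cases
      case 1
      then show ?thesis using reject[OF x] g[OF x] by simp
    next
      case 2
      then show ?thesis using keep[OF x] g[OF x] by (simp add: mult_nonneg_nonpos)
    qed simp
  qed
  also have "\<dots> = (measure_pmf.expectation q f - measure_pmf.expectation q g)
      - k * (measure_pmf.expectation p f - measure_pmf.expectation p g)"
    by (simp add: E supp algebra_simps sum.distrib sum_subtractf sum_distrib_left)
  finally show ?thesis
    using mult_nonneg_nonneg[OF \<open>0 \<le> k\<close>, of "measure_pmf.expectation p f - measure_pmf.expectation p g"]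
      level by linarith
qed

text \<open>
  Take the least \<open>K\<close> whose tail probability \<open>P(T > K)\<close> is at most \<open>\<alpha>\<close>. By minimality
  \<open>P(T \<ge> K) > \<alpha>\<close>, so \<open>K\<close> is an atom and rejecting on a suitable fraction of it
  fills the gap up to \<open>\<alpha>\<close>.
\<close>

lemma ex_randomized_threshold:
  fixes p :: "'b pmf" and T :: "'b \<Rightarrow> int" and \<alpha> :: real
  assumes fin: "finite (set_pmf p)" and \<alpha>: "0 \<le> \<alpha>" "\<alpha> < 1"
  shows "\<exists>K::int. \<exists>\<Gamma>\<in>{0..1}.
    measure_pmf.expectation p (\<lambda>x. if T x > K then 1 else if T x < K then 0 else \<Gamma>) = \<alpha>"
proof -
  define tail where "tail k = measure_pmf.prob p {x. T x > k}" for k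
  define lo where "lo = Min (T ` set_pmf p)"
  define hi where "hi = Max (T ` set_pmf p)"
  have lo: "lo \<le> T x" and hi: "T x \<le> hi" if "x \<in> set_pmf p" for x
    using fin that by (auto simp: lo_def hi_def)
  have "lo \<le> hi"
    using set_pmf_not_empty[of p] lo hi by force
  have tail_hi: "tail hi = 0"
    using hi by (force simp: tail_def measure_pmf_zero_iff)
  have tail_lo: "tail (lo - 1) = 1"
    using lo by (force simp: tail_def measure_pmf.prob_eq_1 AE_measure_pmf_iff)
  \<comment> \<open>The range starts one below the least value of \<open>T\<close>, where the tail probability is \<open>1\<close>: this
    keeps the predecessor of the minimum inside the range.\<close>
  define C where "C = {k \<in> {lo - 1..hi}. tail k \<le> \<alpha>}"
  define K where "K = Min C"
  have "finite C"
    by (rule finite_subset[of _ "{lo - 1..hi}"]) (auto simp: C_def)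
  moreover have "hi \<in> C"
    using tail_hi \<alpha> \<open>lo \<le> hi\<close> by (simp add: C_def)
  ultimately have "K \<in> C" and K_le: "\<And>k. k \<in> C \<Longrightarrow> K \<le> k"
    unfolding K_def using Min_in[of C] Min_le[of C] by blast+
  then have K: "tail K \<le> \<alpha>" "lo - 1 \<le> K" "K \<le> hi" by (auto simp: C_def)
  have "K \<noteq> lo - 1" using K tail_lo \<alpha> by auto
  then have tail_pred: "\<alpha> < tail (K - 1)"
    using K K_le[of "K - 1"] by (force simp: C_def)
  define mass where "mass = measure_pmf.prob p {x. T x = K}"
  have "{x. T x > K - 1} = {x. T x > K} \<union> {x. T x = K}" by auto
  then have split: "tail (K - 1) = tail K + mass"
    unfolding tail_def mass_def
    by (simp add: measure_pmf.finite_measure_Union disjoint_iff)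
  define \<Gamma> where "\<Gamma> = (\<alpha> - tail K) / mass"
  have "mass > 0" using split tail_pred K by linarith
  then have \<Gamma>: "\<Gamma> \<in> {0..1}" "\<Gamma> * mass = \<alpha> - tail K"
    using K split tail_pred by (auto simp: \<Gamma>_def field_simps)
  have "measure_pmf.expectation p (\<lambda>x. if T x > K then 1 else if T x < K then 0 else \<Gamma>)
      = measure_pmf.expectation p (\<lambda>x. indicator {x. T x > K} x + \<Gamma> * indicator {x. T x = K} x)"
    by (rule arg_cong[where f="measure_pmf.expectation p"]) (auto simp: indicator_def)
  also have "\<dots> = tail K + \<Gamma> * mass"
    by (subst Bochner_Integration.integral_add)
       (auto simp: tail_def mass_def intro!: integrable_measure_pmf_finite fin)
  finally have "measure_pmf.expectation p (\<lambda>x. if T x > K then 1 else if T x < K then 0 else \<Gamma>) = \<alpha>"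
    using \<Gamma> by simp
  with \<Gamma> show ?thesis by blast
qed

section \<open>Reversing pairs in a tournament\<close>

text \<open>
  Reversing the pairs of a symmetric set \<open>D\<close> is an involution of the tournaments that preserves
  the Kendall tau distance. Any tournament becomes any other one by reversing the pairs on which they
  disagree, so these involutions carry the model from one hypothesis to another.
\<close>

definition reverse_on :: "'a rel \<Rightarrow> 'a rel \<Rightarrow> 'a rel" where
  "reverse_on D V = {(b, c). (if (b, c) \<in> D then (c, b) else (b, c)) \<in> V}"

lemma reverse_on_involutive: "sym D \<Longrightarrow> reverse_on D (reverse_on D V) = V"
  by (auto simp: reverse_on_def sym_def split: if_splits)

lemma tournaments_iff:
  "V \<in> tournaments A \<longleftrightarrow>
    (\<forall>b c. (b, c) \<in> V \<longrightarrow> b \<in> A \<and> c \<in> A \<and> (c, b) \<notin> V) \<and>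
    (\<forall>b\<in>A. \<forall>c\<in>A. b \<noteq> c \<longrightarrow> (b, c) \<in> V \<or> (c, b) \<in> V)"
  (is "_ \<longleftrightarrow> ?R")
proof
  show "V \<in> tournaments A \<Longrightarrow> ?R"
    by (auto simp: tournaments_def irrefl_def total_on_def dest: antisymD)
  assume ?R
  then show "V \<in> tournaments A"
    unfolding tournaments_def irrefl_def antisym_def total_on_def by auto
qed

lemma tournament_converse_iff:
  "V \<in> tournaments A \<Longrightarrow> b \<in> A \<Longrightarrow> c \<in> A \<Longrightarrow> b \<noteq> c \<Longrightarrow> (c, b) \<in> V \<longleftrightarrow> (b, c) \<notin> V"
  unfolding tournaments_iff by blast

lemma tournament_field: "V \<in> tournaments A \<Longrightarrow> (b, c) \<in> V \<Longrightarrow> b \<in> A \<and> c \<in> A"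
  unfolding tournaments_iff by blast

lemma tournament_irrefl: "V \<in> tournaments A \<Longrightarrow> (b, b) \<notin> V"
  unfolding tournaments_iff by blast

lemma reverse_on_tournament:
  assumes "sym D" "V \<in> tournaments A"
  shows "reverse_on D V \<in> tournaments A"
proof -
  have "(b, c) \<in> reverse_on D V \<longleftrightarrow> (if (b, c) \<in> D then (c, b) \<in> V else (b, c) \<in> V)" for b c
    by (simp add: reverse_on_def)
  then show ?thesis
    using assms(2) symD[OF assms(1)] unfolding tournaments_iff by (smt (verit))
qed

lemma bij_betw_reverse_on:
  "sym D \<Longrightarrow> bij_betw (reverse_on D) (tournaments A) (tournaments A)"
  by (rule bij_betw_byWitness[where f' = "reverse_on D"])
     (auto simp: reverse_on_involutive reverse_on_tournament)

lemma KT_reverse_on: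
  assumes "sym D"
  shows "KT A (reverse_on D V) (reverse_on D W) = KT A V W"
proof -
  let ?S = "\<lambda>V W. {{b, c} | b c. b \<in> A \<and> c \<in> A \<and> b \<noteq> c \<and> ((b, c) \<in> V \<longleftrightarrow> (b, c) \<notin> W)}"
  have sub: "?S (reverse_on D V) (reverse_on D W) \<subseteq> ?S V W" for V W
  proof
    fix e assume "e \<in> ?S (reverse_on D V) (reverse_on D W)"
    then obtain b c where e: "e = {b, c}" "b \<in> A" "c \<in> A" "b \<noteq> c"
      "(b, c) \<in> reverse_on D V \<longleftrightarrow> (b, c) \<notin> reverse_on D W" by auto
    show "e \<in> ?S V W"
    proof (cases "(b, c) \<in> D")
      case True
      with e have "e = {c, b} \<and> c \<in> A \<and> b \<in> A \<and> c \<noteq> b \<and> ((c, b) \<in> V \<longleftrightarrow> (c, b) \<notin> W)"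
        by (auto simp: reverse_on_def)
      then show ?thesis by blast
    next
      case False
      with e show ?thesis by (auto simp: reverse_on_def)
    qed
  qed
  have "?S (reverse_on D V) (reverse_on D W) = ?S V W"
    using sub[of V W] sub[of "reverse_on D V" "reverse_on D W"]
    by (simp only: reverse_on_involutive[OF assms] subset_antisym)
  then show ?thesis by (simp add: KT_def)
qed

lemma condorcet_Z_reverse_on:
  assumes "sym D"
  shows "condorcet_Z A \<phi> (reverse_on D W) = condorcet_Z A \<phi> W"
  unfolding condorcet_Z_def
  by (subst sum.reindex_bij_betw[OF bij_betw_reverse_on[OF assms], symmetric])
     (simp add: KT_reverse_on[OF assms])

text \<open>
  The involution moves the vote and the parameter simultaneously without changing their distance,
  so the model is equivariant under it.
\<close>

lemma condorcet_pmf_reverse_on: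
  assumes "finite A" "0 < \<phi>" "W \<in> tournaments A" "sym D"
  shows "condorcet_pmf A \<phi> (reverse_on D W) = map_pmf (reverse_on D) (condorcet_pmf A \<phi> W)"
proof (rule pmf_eqI)
  fix V
  note rev = reverse_on_tournament[OF \<open>sym D\<close>] and inv = reverse_on_involutive[OF \<open>sym D\<close>]
  have "inj (reverse_on D)" using inv by (metis injI)
  then have "pmf (map_pmf (reverse_on D) (condorcet_pmf A \<phi> W)) (reverse_on D (reverse_on D V))
      = pmf (condorcet_pmf A \<phi> W) (reverse_on D V)"
    by (rule pmf_map_inj')
  moreover have "KT A V (reverse_on D W) = KT A (reverse_on D V) W"
    using KT_reverse_on[OF \<open>sym D\<close>, of A "reverse_on D V" W] by (simp add: inv)
  moreover have "reverse_on D V \<in> tournaments A \<longleftrightarrow> V \<in> tournaments A"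
    using rev inv by metis
  ultimately show "pmf (condorcet_pmf A \<phi> (reverse_on D W)) V
      = pmf (map_pmf (reverse_on D) (condorcet_pmf A \<phi> W)) V"
    using assms by (simp add: inv pmf_condorcet rev condorcet_Z_reverse_on)
qed

lemma profile_pmf_reverse_on:
  assumes "finite A" "0 < \<phi>" "W \<in> tournaments A" "sym D"
  shows "profile_pmf A \<phi> n (reverse_on D W) =
    map_pmf (\<lambda>P i. if i < n then reverse_on D (P i) else undefined) (profile_pmf A \<phi> n W)"
proof -
  \<comment> \<open>A product of mass functions commutes with a map only if the map respects the default value
    outside the index set; hence the detour through the default \<open>reverse_on D undefined\<close>.\<close>
  have "profile_pmf A \<phi> n (reverse_on D W)
      = map_pmf (\<lambda>P i. if i \<in> {..<n} then P i else undefined)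
          (Pi_pmf {..<n} (reverse_on D undefined) (\<lambda>i. map_pmf (reverse_on D) (condorcet_pmf A \<phi> W)))"
    unfolding profile_pmf_def condorcet_pmf_reverse_on[OF assms]
    by (rule Pi_pmf_default_swap[symmetric]) simp
  also have "\<dots> = map_pmf (\<lambda>P i. if i \<in> {..<n} then P i else undefined)
      (map_pmf (\<lambda>P. reverse_on D \<circ> P) (profile_pmf A \<phi> n W))"
    unfolding profile_pmf_def by (subst Pi_pmf_map) auto
  finally show ?thesis
    by (simp add: map_pmf_comp cong: if_cong)
qed

section \<open>The margin test has the same rejection probability under all null hypotheses\<close>

text \<open>
  Reversing the pairs on which \<open>h\<close> and \<open>h'\<close> disagree turns the model at \<open>h\<close> into the model
  at \<open>h'\<close>; none of these pairs contains \<open>a\<close>, and the margin looks only at pairs that do.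
\<close>

lemma size_at_margin_test_eq:
  assumes "finite A" "0 < \<phi>" "a \<in> A" "h \<in> top_tournaments A a" "h' \<in> top_tournaments A a"
  shows "size_at A \<phi> n (margin_test n a B K \<Gamma>) h = size_at A \<phi> n (margin_test n a B K \<Gamma>) h'"
proof -
  define D where "D = {(b, c). ((b, c) \<in> h) \<noteq> ((b, c) \<in> h') \<or> ((c, b) \<in> h) \<noteq> ((c, b) \<in> h')}"
  have t: "h \<in> tournaments A" "h' \<in> tournaments A"
    and top: "\<And>b. b \<in> A \<Longrightarrow> b \<noteq> a \<Longrightarrow> (a, b) \<in> h \<and> (a, b) \<in> h'"
    using assms by (auto simp: top_tournaments_def)
  have D: "sym D" by (auto simp: D_def sym_def)
  have h': "h' = reverse_on D h"
  proof -
    have "(b, c) \<in> h' \<longleftrightarrow> (b, c) \<in> reverse_on D h" for b c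
    proof (cases "b \<in> A \<and> c \<in> A \<and> b \<noteq> c")
      case True
      then show ?thesis
        using t[THEN tournament_converse_iff, of b c] by (auto simp: reverse_on_def D_def)
    next
      case False
      then show ?thesis
        using t unfolding tournaments_iff reverse_on_def by auto
    qed
    then show ?thesis by auto
  qed
  have Da: "(b, a) \<notin> D" "(a, b) \<notin> D" for b
  proof -
    have "((a, b) \<in> h \<longleftrightarrow> (a, b) \<in> h') \<and> ((b, a) \<in> h \<longleftrightarrow> (b, a) \<in> h')"
    proof (cases "b \<in> A \<and> b \<noteq> a")
      case True
      then show ?thesis using t[THEN tournament_converse_iff, of a b] top[of b] \<open>a \<in> A\<close> by auto
    next
      case False
      then show ?thesis using t[THEN tournament_field] t[THEN tournament_irrefl] by blast
    qed
    then show "(b, a) \<notin> D" "(a, b) \<notin> D" by (auto simp: D_def)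
  qed
  have "margin_test n a B K \<Gamma> (\<lambda>i. if i < n then reverse_on D (P i) else undefined)
      = margin_test n a B K \<Gamma> P" for P
    using Da by (simp add: margin_test_def set_margin_def margin_def votes_def reverse_on_def
      cong: conj_cong)
  then show ?thesis
    unfolding size_at_def h' profile_pmf_reverse_on[OF assms(1,2) t(1) D] by simp
qed

section \<open>The likelihood ratio is monotone in the margin\<close>

lemma set_margin_eq_sum:
  assumes "finite B"
  shows "set_margin n P B a =
    (\<Sum>i<n. int (card {b \<in> B. (b, a) \<in> P i}) - int (card {b \<in> B. (a, b) \<in> P i}))"
proof -
  have card_sum: "int (card {x \<in> X. Q x}) = (\<Sum>x\<in>X. of_bool (Q x))" if "finite X"
    for X :: "'x set" and Q
    using that by (simp add: sum.If_cases of_bool_def Int_def conj_commute)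
  show ?thesis
    unfolding set_margin_def margin_def votes_def sum_subtractf
      card_sum[OF assms] card_sum[OF finite_lessThan]
    by (intro arg_cong2[where f = "(-)"] sum.swap)
qed

text \<open>
  From here on \<open>D\<close> consists of the pairs in which \<open>a\<close> loses under \<open>h1\<close>, in both orders. The relation
  \<open>reverse_on D h1\<close> is the member of the null hypothesis closest to \<open>h1\<close>; it plays the part
  of the simple null hypothesis.
\<close>

context
  fixes A :: "'a set" and a :: 'a and h1 :: "'a rel" and B :: "'a set" and D :: "'a rel"
  assumes finA: "finite A" and aA: "a \<in> A" and h1: "h1 \<in> tournaments A"
    and B_eq: "B = {b \<in> A. (b, a) \<in> h1}"
    and D_eq: "D = B \<times> {a} \<union> {a} \<times> B"
begin

lemma sym_D: "sym D"
  by (auto simp: D_eq sym_def)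

lemma reverse_on_top: "reverse_on D h1 \<in> top_tournaments A a"
  unfolding top_tournaments_def
proof (intro CollectI conjI ballI)
  fix b assume b: "b \<in> A - {a}"
  show "(a, b) \<in> reverse_on D h1"
  proof (cases "b \<in> B")
    case True
    then show ?thesis by (simp add: reverse_on_def D_eq B_eq)
  next
    case False
    then show ?thesis
      using b tournament_converse_iff[OF h1 aA, of b] by (auto simp: reverse_on_def D_eq B_eq)
  qed
qed (rule reverse_on_tournament[OF sym_D h1])

text \<open>
  The disagreements of \<open>V\<close> with the two hypotheses coincide outside the pairs \<open>{a, b}\<close> with
  \<open>b \<in> B\<close>. Such a pair is a disagreement with \<open>h1\<close> if \<open>a\<close> wins it in \<open>V\<close>, and with the
  reversed relation if \<open>b\<close> does. The identity is stated without subtraction, the distances being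
  natural numbers.
\<close>

lemma KT_reverse_on_balance:
  assumes V: "V \<in> tournaments A"
  shows "KT A V h1 + card {b \<in> B. (b, a) \<in> V}
       = KT A V (reverse_on D h1) + card {b \<in> B. (a, b) \<in> V}"
proof -
  define S where "S W = {{b, c} | b c. b \<in> A \<and> c \<in> A \<and> b \<noteq> c \<and> ((b, c) \<in> V \<longleftrightarrow> (b, c) \<notin> W)}" for W
  define E where "E = (\<lambda>b. {a, b}) ` B"
  have aB: "a \<notin> B" using tournament_irrefl[OF h1] by (simp add: B_eq)
  have fin: "finite (S W)" for W
    by (rule finite_subset[of _ "Pow A"]) (use finA in \<open>auto simp: S_def\<close>)
  have inj: "inj_on (\<lambda>b. {a, b}) X" for X
    by (auto simp: inj_on_def doubleton_eq_iff)
  have card: "KT A V W = card (S W - E) + card (S W \<inter> E)" for W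
    unfolding KT_def S_def[symmetric] using card_Int_Diff[OF fin, of W E] by simp
  \<comment> \<open>On tournaments the disagreement condition is symmetric, so membership of an unordered pair can
    be read off from either of its orderings.\<close>
  have mem: "{b, c} \<in> S W \<longleftrightarrow> b \<in> A \<and> c \<in> A \<and> b \<noteq> c \<and> ((b, c) \<in> V \<longleftrightarrow> (b, c) \<notin> W)"
    if "W \<in> tournaments A" for b c W
  proof -
    have "((c, b) \<in> V \<longleftrightarrow> (c, b) \<notin> W) \<longleftrightarrow> ((b, c) \<in> V \<longleftrightarrow> (b, c) \<notin> W)"
      if "b \<in> A" "c \<in> A" "b \<noteq> c"
      using that tournament_converse_iff V \<open>W \<in> tournaments A\<close> by metis
    then show ?thesis unfolding S_def mem_Collect_eq doubleton_eq_iff by metis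
  qed
  note h0 = reverse_on_tournament[OF sym_D h1]
  have outside: "S h1 - E = S (reverse_on D h1) - E"
  proof (rule set_eqI)
    fix e
    show "e \<in> S h1 - E \<longleftrightarrow> e \<in> S (reverse_on D h1) - E"
    proof (cases "\<exists>b c. e = {b, c}")
      case True
      then obtain b c where e: "e = {b, c}" by auto
      have "e \<notin> E \<Longrightarrow> (b, c) \<notin> D" by (auto simp: e E_def D_eq)
      then show ?thesis
        unfolding Diff_iff e mem[OF h1] mem[OF h0] by (auto simp: reverse_on_def)
    next
      case False
      then show ?thesis by (auto simp: S_def)
    qed
  qed
  have in1: "S h1 \<inter> E = (\<lambda>b. {a, b}) ` {b \<in> B. (a, b) \<in> V}"
  proof -
    have "{a, b} \<in> S h1 \<longleftrightarrow> (a, b) \<in> V" if "b \<in> B" for b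
      unfolding mem[OF h1] using that aA aB tournament_converse_iff[OF h1 aA, of b]
      by (auto simp: B_eq)
    then show ?thesis unfolding E_def by blast
  qed
  have in0: "S (reverse_on D h1) \<inter> E = (\<lambda>b. {a, b}) ` {b \<in> B. (b, a) \<in> V}"
  proof -
    have "{a, b} \<in> S (reverse_on D h1) \<longleftrightarrow> (b, a) \<in> V" if "b \<in> B" for b
      unfolding mem[OF h0] using that aA aB tournament_converse_iff[OF V aA, of b]
      by (auto simp: B_eq D_eq reverse_on_def)
    then show ?thesis unfolding E_def by blast
  qed
  show ?thesis
    unfolding card outside in1 in0 by (simp add: card_image[OF inj])
qed

text \<open>
  The normalization factors cancel because they agree for all parameters; the exponents of the
  votes add up to the margin of the profile.
\<close>

lemma profile_likelihood_ratio:
  assumes \<phi>: "0 < \<phi>" and P: "P \<in> profiles A n"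
  shows "pmf (profile_pmf A \<phi> n h1) P =
    \<phi> powr (- set_margin n P B a) * pmf (profile_pmf A \<phi> n (reverse_on D h1)) P"
proof -
  note h0 = reverse_on_tournament[OF sym_D h1]
  have finB: "finite B" using finA by (simp add: B_eq)
  define w where "w V = int (card {b \<in> B. (b, a) \<in> V}) - int (card {b \<in> B. (a, b) \<in> V})" for V
  have vote: "pmf (condorcet_pmf A \<phi> h1) V = \<phi> powr (- w V) * pmf (condorcet_pmf A \<phi> (reverse_on D h1)) V"
    if V: "V \<in> tournaments A" for V
  proof -
    have "real (KT A V h1) = - w V + real (KT A V (reverse_on D h1))"
      using KT_reverse_on_balance[OF V] by (simp add: w_def)
    then have "\<phi> ^ KT A V h1 = \<phi> powr (- w V) * \<phi> ^ KT A V (reverse_on D h1)"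
      using powr_realpow[OF \<phi>] by (metis powr_add)
    then show ?thesis
      using V by (simp add: pmf_condorcet finA \<phi> h1 h0 condorcet_Z_reverse_on[OF sym_D])
  qed
  have prof: "pmf (profile_pmf A \<phi> n W) P = (\<Prod>i<n. pmf (condorcet_pmf A \<phi> W) (P i))" for W
    unfolding profile_pmf_def using P by (subst pmf_Pi') (auto simp: profiles_def PiE_def extensional_def)
  have "pmf (profile_pmf A \<phi> n h1) P =
      (\<Prod>i<n. \<phi> powr (- w (P i)) * pmf (condorcet_pmf A \<phi> (reverse_on D h1)) (P i))"
    unfolding prof using P by (intro prod.cong refl vote) (auto simp: profiles_def)
  also have "\<dots> = \<phi> powr (\<Sum>i<n. - w (P i)) * pmf (profile_pmf A \<phi> n (reverse_on D h1)) P"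
    using \<phi> by (simp add: prod.distrib prof powr_sum)
  also have "(\<Sum>i<n. - w (P i)) = - set_margin n P B a"
    unfolding set_margin_eq_sum[OF finB] w_def sum_negf ..
  finally show ?thesis .
qed

end

section \<open>Optimality of the margin test\<close>

theorem theorem6:
  fixes A :: "'a set" and a :: 'a and h1 :: "'a rel" and B :: "'a set"
    and \<phi> \<alpha> :: real and n :: nat
  assumes "finite A" and "card A \<ge> 2"
    and "0 < \<phi>" and "\<phi> < 1"
    and "n \<ge> 1"
    and "a \<in> A"
    and "h1 \<in> tournaments A - top_tournaments A a"
    and "0 < \<alpha>" and "\<alpha> < 1"
    and "B = {b \<in> A. (b, a) \<in> h1}"
  shows "(\<exists>K \<Gamma>. \<Gamma> \<in> {0..1} \<and>
            test_size A \<phi> n (margin_test n a B K \<Gamma>) (top_tournaments A a) = \<alpha>) \<and>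
         (\<forall>K \<Gamma>. \<Gamma> \<in> {0..1} \<and>
            test_size A \<phi> n (margin_test n a B K \<Gamma>) (top_tournaments A a) = \<alpha> \<longrightarrow>
            most_powerful_test A \<phi> n \<alpha> (top_tournaments A a) h1 (margin_test n a B K \<Gamma>))"
proof -
  define D where "D = B \<times> {a} \<union> {a} \<times> B"
  define h0 where "h0 = reverse_on D h1"
  have h1: "h1 \<in> tournaments A" using assms by auto
  note ctx = assms(1,6) h1 assms(10) D_def
  have h0_top: "h0 \<in> top_tournaments A a"
    unfolding h0_def by (rule reverse_on_top[OF ctx])
  then have h0: "h0 \<in> tournaments A" by (simp add: top_tournaments_def)
  note fin_tour = finite_tournaments[OF \<open>finite A\<close>]
  have finP: "finite (profiles A n)"
    unfolding profiles_def using fin_tour by (intro finite_PiE) auto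
  note supp = set_profile_pmf[OF \<open>finite A\<close> \<open>0 < \<phi>\<close>]
  have size: "test_size A \<phi> n (margin_test n a B K \<Gamma>) (top_tournaments A a)
      = size_at A \<phi> n (margin_test n a B K \<Gamma>) h0" for K \<Gamma>
  proof -
    have "size_at A \<phi> n (margin_test n a B K \<Gamma>) ` top_tournaments A a
        = {size_at A \<phi> n (margin_test n a B K \<Gamma>) h0}"
      using size_at_margin_test_eq[OF \<open>finite A\<close> \<open>0 < \<phi>\<close> \<open>a \<in> A\<close> _ h0_top] h0_top by blast
    then show ?thesis by (simp add: test_size_def)
  qed
  have size_ge: "size_at A \<phi> n g h0 \<le> test_size A \<phi> n g (top_tournaments A a)" for g
  proof -
    have "finite (top_tournaments A a)"
      using fin_tour by (rule finite_subset[rotated]) (auto simp: top_tournaments_def)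
    then show ?thesis
      unfolding test_size_def by (intro cSUP_upper h0_top) auto
  qed
  have powr_antimono: "y < x" if "\<phi> powr x < \<phi> powr y" for x y
    using that powr_mono'[of x y \<phi>] assms by force
  have "\<exists>K \<Gamma>. \<Gamma> \<in> {0..1} \<and> size_at A \<phi> n (margin_test n a B K \<Gamma>) h0 = \<alpha>"
  proof -
    obtain K :: int and \<Gamma> where \<Gamma>: "\<Gamma> \<in> {0..1}"
      and E: "measure_pmf.expectation (profile_pmf A \<phi> n h0)
        (\<lambda>P. if set_margin n P B a > K then 1 else if set_margin n P B a < K then 0 else \<Gamma>) = \<alpha>"
      using ex_randomized_threshold[of "profile_pmf A \<phi> n h0" \<alpha> "\<lambda>P. set_margin n P B a"]
        assms finP supp[OF h0] by auto
    have "margin_test n a B (of_int K) \<Gamma> =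
        (\<lambda>P. if set_margin n P B a > K then 1 else if set_margin n P B a < K then 0 else \<Gamma>)"
      by (auto simp: margin_test_def)
    with \<Gamma> E show ?thesis unfolding size_at_def by metis
  qed
  moreover have "most_powerful_test A \<phi> n \<alpha> (top_tournaments A a) h1 (margin_test n a B K \<Gamma>)"
    if \<Gamma>: "\<Gamma> \<in> {0..1}" and level: "size_at A \<phi> n (margin_test n a B K \<Gamma>) h0 = \<alpha>" for K \<Gamma>
    unfolding most_powerful_test_def
  proof (intro conjI allI impI)
    show "is_test A n (margin_test n a B K \<Gamma>)"
      using \<Gamma> by (auto simp: is_test_def margin_test_def)
    show "test_size A \<phi> n (margin_test n a B K \<Gamma>) (top_tournaments A a) = \<alpha>"
      using level size by simp
  next
    fix g
    assume g: "is_test A n g \<and> test_size A \<phi> n g (top_tournaments A a) \<le> \<alpha>"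
    have ratio: "pmf (profile_pmf A \<phi> n h1) P =
        \<phi> powr (- set_margin n P B a) * pmf (profile_pmf A \<phi> n h0) P" if "P \<in> profiles A n" for P
      unfolding h0_def by (rule profile_likelihood_ratio[OF ctx \<open>0 < \<phi>\<close> that])
    have pos: "0 < pmf (profile_pmf A \<phi> n h0) P" if "P \<in> profiles A n" for P
      using that supp[OF h0, of n] by (auto simp: pmf_positive_iff)
    show "test_power A \<phi> n g h1 \<le> test_power A \<phi> n (margin_test n a B K \<Gamma>) h1"
      unfolding test_power_def
      \<comment> \<open>Margin \<open>K\<close> corresponds to the likelihood ratio \<open>\<phi> powr (- K)\<close>, whence the
        critical value \<open>k\<close>.\<close>
    proof (rule neyman_pearson[where S = "profiles A n" and p = "profile_pmf A \<phi> n h0"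
          and k = "\<phi> powr (- K)"])
      show "measure_pmf.expectation (profile_pmf A \<phi> n h0) g
          \<le> measure_pmf.expectation (profile_pmf A \<phi> n h0) (margin_test n a B K \<Gamma>)"
        using g level size_ge[of g] by (simp add: size_at_def)
    next
      fix P assume P: "P \<in> profiles A n"
        and "pmf (profile_pmf A \<phi> n h1) P > \<phi> powr (- K) * pmf (profile_pmf A \<phi> n h0) P"
      then have "\<phi> powr (- K) < \<phi> powr (- set_margin n P B a)"
        using ratio[OF P] pos[OF P] by simp
      from powr_antimono[OF this] show "margin_test n a B K \<Gamma> P = 1"
        by (simp add: margin_test_def)
    next
      fix P assume P: "P \<in> profiles A n"
        and "pmf (profile_pmf A \<phi> n h1) P < \<phi> powr (- K) * pmf (profile_pmf A \<phi> n h0) P"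
      then have "\<phi> powr (- set_margin n P B a) < \<phi> powr (- K)"
        using ratio[OF P] pos[OF P] by simp
      from powr_antimono[OF this] show "margin_test n a B K \<Gamma> P = 0"
        by (simp add: margin_test_def)
    qed (use g finP supp[OF h0] supp[OF h1] in \<open>auto simp: is_test_def\<close>)
  qed
  ultimately show ?thesis by (simp add: size)
qed

end
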